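(* Let $F:\mathbb{R}\multimap\mathbb{R}$ be a cyclically quasi-monotone multi-map (with full domain). Then there exists a lower semi-continuous quasi-convex function $f:\mathbb{R}\to\mathbb{R}$ such that $F(x)\subseteq \mathrm{N}f(x)$ for every $x\in\mathbb{R}$.
   Context: A multi-map $F:\mathbb{R}\multimap\mathbb{R}$ is a map from $\mathbb{R}$ to $2^{\mathbb{R}}$; it has full domain if $F(x)\ne\emptyset$ for every $x$. A multi-map $F$ with full domain is cyclically quasi-monotone if for every integer $N\ge1$, every $x_0,\dots,x_N\in\mathbb{R}$ with $x_N=x_0$ and every $p_0\in F(x_0),\dots,p_{N-1}\in F(x_{N-1})$, one has $\min_{0\le i<N}(x_{i+1}-x_i)\cdot p_i\le 0$. A function $f:\mathbb{R}\to\mathbb{R}$ is quasi-convex if $\{x:f(x)\le\ell\}$ is convex for every $\ell\in\mathbb{R}$. Its normal cone multi-map is $\mathrm{N}f(x)=\{p\in\mathbb{R}:\forall w\in\mathbb{R},\ f(w)\le f(x)\implies p\cdot(w-x)\le0\}$. *)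

theory Defs
  imports "HOL-Analysis.Analysis"
begin

definition full_domain :: "(real \<Rightarrow> real set) \<Rightarrow> bool" where
  "full_domain F \<longleftrightarrow> (\<forall>x. F x \<noteq> {})"

(* The finite families x_0, ..., x_N and p_0, ..., p_(N-1) are represented by functions on nat;
   their values at larger indices play no role. *)
definition cyclically_quasi_monotone :: "(real \<Rightarrow> real set) \<Rightarrow> bool" where
  "cyclically_quasi_monotone F \<longleftrightarrow>
     (\<forall>N::nat. N \<ge> 1 \<longrightarrow>
       (\<forall>(x :: nat \<Rightarrow> real) (p :: nat \<Rightarrow> real).
          x N = x 0 \<longrightarrow> (\<forall>i<N. p i \<in> F (x i)) \<longrightarrow>
          Min ((\<lambda>i. (x (Suc i) - x i) * p i) ` {0..<N}) \<le> 0))"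

definition quasi_convex :: "(real \<Rightarrow> real) \<Rightarrow> bool" where
  "quasi_convex f \<longleftrightarrow> (\<forall>l. convex {x. f x \<le> l})"

definition lower_semicontinuous :: "(real \<Rightarrow> real) \<Rightarrow> bool" where
  "lower_semicontinuous f \<longleftrightarrow> (\<forall>x. \<forall>l < f x. \<forall>\<^sub>F w in nhds x. l < f w)"

definition normal_cone :: "(real \<Rightarrow> real) \<Rightarrow> real \<Rightarrow> real set" where
  "normal_cone f x = {p. \<forall>w. f w \<le> f x \<longrightarrow> p * (w - x) \<le> 0}"

end

(* Already 2-cycles force every point carrying a negative value of F to lie to the left of every
   point carrying a positive one. If c separates these two sets, then f x = |x - c| works;
   if there are no negative or no positive values, take f x = x or f x = -x. *)
theory Submission
  imports Defs
begin

lemma lower_semicontinuous_if_continuous: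
  assumes "\<And>x. isCont f x"
  shows "lower_semicontinuous f"
  unfolding lower_semicontinuous_def
proof (intro allI impI)
  fix x l assume "l < f x"
  moreover have "(f \<longlongrightarrow> f x) (nhds x)"
    using assms[of x] by (simp add: continuous_at tendsto_at_iff_tendsto_nhds)
  ultimately show "\<forall>\<^sub>F w in nhds x. l < f w"
    by (rule order_tendstoD(1)[rotated])
qed

text \<open>The case \<open>N = 2\<close> of the definition, applied to the cycle \<open>x\<close>,
  \<open>y\<close>, \<open>x\<close>: a minimum of two numbers is at most 0 iff one of them
  is.\<close>

lemma cyclically_quasi_monotone_pair:
  assumes "cyclically_quasi_monotone F" and "p \<in> F x" and "q \<in> F y"
  shows "(y - x) * p \<le> 0 \<or> (x - y) * q \<le> 0"
proof -
  \<comment> \<open>Only index 1 carries \<open>y\<close> and \<open>q\<close>, so index 2 falls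
    back to \<open>x\<close> and the cycle closes.\<close>
  define xs where "xs i = (if i = Suc 0 then y else x)" for i :: nat
  define ps where "ps i = (if i = Suc 0 then q else p)" for i :: nat
  have "xs 2 = xs 0" "\<forall>i<2. ps i \<in> F (xs i)"
    using assms(2,3) by (auto simp: xs_def ps_def)
  then have "Min ((\<lambda>i. (xs (Suc i) - xs i) * ps i) ` {0..<2}) \<le> 0"
    using assms(1) unfolding cyclically_quasi_monotone_def by (metis one_le_numeral)
  moreover have "{0..<2::nat} = {0, Suc 0}"
    by auto
  ultimately show ?thesis
    by (simp add: xs_def ps_def min_le_iff_disj)
qed

text \<open>If \<open>x < y\<close>, then \<open>p\<close> points from \<open>x\<close> towards
  \<open>y\<close> and \<open>q\<close> from \<open>y\<close> towards \<open>x\<close>, so both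
  products of the 2-cycle would be positive.\<close>

lemma neg_le_pos_if_cyclically_quasi_monotone:
  assumes "cyclically_quasi_monotone F"
    and "p \<in> F x" "p > 0" and "q \<in> F y" "q < 0"
  shows "y \<le> x"
proof (rule ccontr)
  assume "\<not> y \<le> x"
  then have "(y - x) * p > 0" "(x - y) * q > 0"
    using assms by (auto intro: mult_pos_pos mult_neg_neg)
  then show False
    using cyclically_quasi_monotone_pair[OF assms(1,2,4)] by linarith
qed

text \<open>On the line only the sign of \<open>p\<close> matters: a \<open>w\<close> with
  \<open>p * (w - x) > 0\<close> lies strictly on the side of \<open>x\<close> to which
  \<open>p\<close> points, and there \<open>f\<close> exceeds \<open>f x\<close>. The value 0 lies
  in every normal cone.\<close>

lemma in_normal_coneI:
  assumes "\<And>w. p > 0 \<Longrightarrow> x < w \<Longrightarrow> f x < f w"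
    and "\<And>w. p < 0 \<Longrightarrow> w < x \<Longrightarrow> f x < f w"
  shows "p \<in> normal_cone f x"
  unfolding normal_cone_def
proof (intro CollectI allI impI)
  fix w assume "f w \<le> f x"
  then have "p > 0 \<Longrightarrow> w \<le> x" "p < 0 \<Longrightarrow> x \<le> w"
    using assms by (meson not_le)+
  then show "p * (w - x) \<le> 0"
    by (cases p "0 :: real" rule: linorder_cases) (auto simp: mult_le_0_iff)
qed

theorem theorem3p3:
  fixes F :: "real \<Rightarrow> real set"
  assumes "full_domain F"
    and "cyclically_quasi_monotone F"
  shows "\<exists>f :: real \<Rightarrow> real.
    lower_semicontinuous f \<and> quasi_convex f \<and> (\<forall>x. F x \<subseteq> normal_cone f x)"
proof -
  define P where "P = {x. \<exists>p\<in>F x. p > 0}"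
  define M where "M = {x. \<exists>p\<in>F x. p < 0}"
  have le: "y \<le> x" if "x \<in> P" "y \<in> M" for x y
    using that neg_le_pos_if_cyclically_quasi_monotone[OF assms(2)] by (auto simp: P_def M_def)
  \<comment> \<open>It remains to find an \<open>f\<close> that grows to the right of each point of
    \<open>P\<close> and to the left of each point of \<open>M\<close>.\<close>
  have cone: "\<forall>x. F x \<subseteq> normal_cone f x"
    if "\<And>x w. x \<in> P \<Longrightarrow> x < w \<Longrightarrow> f x < f w" "\<And>x w. x \<in> M \<Longrightarrow> w < x \<Longrightarrow> f x < f w" for f
    by (intro allI subsetI in_normal_coneI) (use that in \<open>unfold P_def M_def, blast+\<close>)
  consider "M = {}" | "P = {}" | "M \<noteq> {}" "P \<noteq> {}"
    by blast
  then show ?thesis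
  proof cases
    case 1
    \<comment> \<open>With \<open>M\<close> empty only the condition on \<open>P\<close> is left,
      and any strictly increasing function meets it.\<close>
    have "quasi_convex (\<lambda>x. x)"
      by (simp add: quasi_convex_def flip: atMost_def)
    with 1 show ?thesis
      by (intro exI[of _ "\<lambda>x. x"] conjI lower_semicontinuous_if_continuous cone) auto
  next
    case 2
    have "{x. - x \<le> l} = {- l..}" for l :: real
      by auto
    then have "quasi_convex uminus"
      by (simp add: quasi_convex_def)
    with 2 show ?thesis
      by (intro exI[of _ uminus] conjI lower_semicontinuous_if_continuous cone) auto
  next
    case 3
    \<comment> \<open>By \<open>le\<close>, each point of \<open>P\<close> is an upper bound of
      \<open>M\<close>; hence the supremum exists and lies between the two sets.\<close>
    define c where "c = Sup M"
    have "bdd_above M"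
      using 3 le by (meson bdd_above.I ex_in_conv)
    then have M: "x \<le> c" if "x \<in> M" for x
      using that by (simp add: c_def cSup_upper)
    have P: "c \<le> x" if "x \<in> P" for x
      using that 3 le by (auto simp: c_def intro!: cSup_least)
    \<comment> \<open>For negative \<open>l\<close> both sides are empty.\<close>
    have "{x. \<bar>x - c\<bar> \<le> l} = cball c l" for l
      by (auto simp: dist_real_def)
    then have "quasi_convex (\<lambda>x. \<bar>x - c\<bar>)"
      by (simp add: quasi_convex_def)
    \<comment> \<open>The distance to \<open>c\<close> strictly increases when moving away from
      \<open>c\<close>. This includes a start at \<open>c\<close> itself, which may belong to
      \<open>P\<close>, to \<open>M\<close> or to both.\<close>
    moreover have "\<forall>x. F x \<subseteq> normal_cone (\<lambda>x. \<bar>x - c\<bar>) x"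
      by (rule cone) (use M P in force)+
    ultimately show ?thesis
      by (intro exI[of _ "\<lambda>x. \<bar>x - c\<bar>"] conjI lower_semicontinuous_if_continuous) auto
  qed
qed

end
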